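(* For all positive integers $n$ and $k$, $$\left(P_{k,n}^{(0)},P_{k,n}^{(1)},\dots,P_{k,n}^{(n)}\right)^{t}=\frac{1}{|\mathcal{IS}_n|^k}\,\mathcal{A}^{k-1}\cdot(1,1,\dots,1)^{t},$$ where $\mathcal{A}=(A_{i,j})_{0\le i,j\le n}$ is the $(n+1)\times(n+1)$-matrix with $$A_{i,j}=\begin{cases}\binom{n-i}{j-i}\binom{n}{j}\,j!\,I(n-i,n-j),&\text{if } i\le j,\\ 0,&\text{otherwise.}\end{cases}$$
   Context: $\mathcal{IS}_n$ is the symmetric inverse semigroup of all partial injective maps from $\{1,\dots,n\}$ to itself, under composition of partial maps, with products read left to right ($x_1$ is applied first in $x_1x_2\cdots x_k$). The rank of $\alpha\in\mathcal{IS}_n$ is $|\operatorname{dom}(\alpha)|$. Let $x_1,\dots,x_k$ be chosen independently and uniformly at random from $\mathcal{IS}_n$. For $0\le i\le n$, $P_{k,n}^{(i)}$ is the probability that the product $x_1x_2\cdots x_k$ equals a fixed element of $\mathcal{IS}_n$ of rank $i$; this probability does not depend on the choice of the element of rank $i$. For non-negative integers $i,j$, $I(i,j)$ is the number of partial injections from $\{1,\dots,i\}$ to $\{1,\dots,j\}$, i.e. $I(i,j)=\sum_{k=0}^{\min(i,j)}\binom{i}{k}\binom{j}{k}k!$. *)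

theory Defs
  imports "HOL-Probability.Probability_Mass_Function" "Jordan_Normal_Form.Matrix"
begin

definition partial_injections :: "nat \<Rightarrow> nat \<Rightarrow> (nat \<rightharpoonup> nat) set" where
  "partial_injections i j = {f. dom f \<subseteq> {1..i} \<and> ran f \<subseteq> {1..j} \<and> inj_on f (dom f)}"

definition num_partial_injections :: "nat \<Rightarrow> nat \<Rightarrow> nat" where
  "num_partial_injections i j = card (partial_injections i j)"

definition IS :: "nat \<Rightarrow> (nat \<rightharpoonup> nat) set" where
  "IS n = partial_injections n n"

definition map_rank :: "(nat \<rightharpoonup> nat) \<Rightarrow> nat" where
  "map_rank \<alpha> = card (dom \<alpha>)"

text \<open>Products are read from left to right: in \<open>pmult f g\<close> the map \<open>f\<close> is applied first.\<close>

definition pmult :: "(nat \<rightharpoonup> nat) \<Rightarrow> (nat \<rightharpoonup> nat) \<Rightarrow> (nat \<rightharpoonup> nat)" where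
  "pmult f g = g \<circ>\<^sub>m f"

definition IS_one :: "nat \<Rightarrow> (nat \<rightharpoonup> nat)" where
  "IS_one n = Some |` {1..n}"

definition IS_prod :: "nat \<Rightarrow> (nat \<rightharpoonup> nat) list \<Rightarrow> (nat \<rightharpoonup> nat)" where
  "IS_prod n xs = foldr pmult xs (IS_one n)"

text \<open>\<open>replicate_pmf k p\<close> is the law of a list of \<open>k\<close> independent samples from \<open>p\<close>.\<close>

definition prod_prob :: "nat \<Rightarrow> nat \<Rightarrow> (nat \<rightharpoonup> nat) \<Rightarrow> real" where
  "prod_prob k n \<alpha> =
     measure_pmf.prob (replicate_pmf k (pmf_of_set (IS n))) {xs. IS_prod n xs = \<alpha>}"

text \<open>The common value of \<open>prod_prob k n\<close> on the elements of rank \<open>i\<close>. Its existence and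
  uniqueness, for \<open>k \<ge> 1\<close> and \<open>i \<le> n\<close>, are \<open>prod_prob_eq_P\<close> and \<open>ex_rank\<close> below.\<close>

definition P :: "nat \<Rightarrow> nat \<Rightarrow> nat \<Rightarrow> real" where
  "P k n i = (THE p. \<forall>\<alpha>\<in>IS n. map_rank \<alpha> = i \<longrightarrow> prod_prob k n \<alpha> = p)"

definition transfer_matrix :: "nat \<Rightarrow> real mat" where
  "transfer_matrix n = mat (n + 1) (n + 1) (\<lambda>(i, j).
     if i \<le> j
     then real (((n - i) choose (j - i)) * (n choose j) * fact j
                * num_partial_injections (n - i) (n - j))
     else 0)"

lemma finite_partial_injections: "finite (partial_injections i j)"
proof -
  have "partial_injections i j \<subseteq> (\<Union>A\<in>Pow {1..i}. {f. dom f = A \<and> ran f \<subseteq> {1..j}})"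
    by (auto simp: partial_injections_def)
  moreover have "finite (\<Union>A\<in>Pow {1..i}. {f. dom f = A \<and> ran f \<subseteq> {1..j}})"
    by (intro finite_UN_I) (auto intro!: finite_set_of_finite_maps intro: finite_subset)
  ultimately show ?thesis by (rule finite_subset)
qed

lemma finite_IS: "finite (IS n)"
  by (simp add: IS_def finite_partial_injections)

lemma IS_iff: "\<alpha> \<in> IS n \<longleftrightarrow> dom \<alpha> \<subseteq> {1..n} \<and> ran \<alpha> \<subseteq> {1..n} \<and> inj_on \<alpha> (dom \<alpha>)"
  by (simp add: IS_def partial_injections_def)

lemma ex_rank: "i \<le> n \<Longrightarrow> \<exists>\<alpha>\<in>IS n. map_rank \<alpha> = i"
proof (rule bexI[of _ "Some |` {1..i}"])
  have d: "dom (Some |` {1..i}) = {1..i}" by (auto simp: dom_def restrict_map_def)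
  show "map_rank (Some |` {1..i}) = i" by (simp add: map_rank_def d)
  assume "i \<le> n"
  then show "Some |` {1..i} \<in> IS n"
    by (auto simp: IS_iff d ran_def restrict_map_def inj_on_def split: if_splits)
qed

lemma IS_nonempty: "IS n \<noteq> {}"
  using ex_rank[of 0 n] by auto

lemma pmult_IS_one: "\<alpha> \<in> IS n \<Longrightarrow> pmult \<alpha> (IS_one n) = \<alpha>"
  by (rule ext)
    (auto simp: pmult_def IS_one_def map_comp_def restrict_map_def IS_iff ran_def
          split: option.splits)

text \<open>Relabelling the domain, and the range, by a permutation of \<open>{1..n}\<close>.\<close>

definition perm_left :: "(nat \<Rightarrow> nat) \<Rightarrow> (nat \<rightharpoonup> nat) \<Rightarrow> (nat \<rightharpoonup> nat)" where
  "perm_left p \<alpha> = \<alpha> \<circ> p"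

definition perm_right :: "(nat \<Rightarrow> nat) \<Rightarrow> (nat \<rightharpoonup> nat) \<Rightarrow> (nat \<rightharpoonup> nat)" where
  "perm_right q \<alpha> = map_option q \<circ> \<alpha>"

lemma pmult_perm_left: "pmult (perm_left p \<alpha>) \<gamma> = perm_left p (pmult \<alpha> \<gamma>)"
  by (rule ext) (simp add: pmult_def perm_left_def map_comp_def)

lemma pmult_perm_right: "pmult \<alpha> (perm_right q \<gamma>) = perm_right q (pmult \<alpha> \<gamma>)"
  by (rule ext) (simp add: pmult_def perm_right_def map_comp_def split: option.splits)

lemma inj_perm_left:
  assumes "p permutes {1..n}" shows "inj (perm_left p)"
proof (rule injI, rule ext)
  fix \<alpha> \<beta> y assume eq: "perm_left p \<alpha> = perm_left p \<beta>"
  obtain x where "y = p x" using permutes_surj[OF assms] by (metis surjD)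
  then show "\<alpha> y = \<beta> y" using fun_cong[OF eq, of x] by (simp add: perm_left_def)
qed

lemma inj_perm_right:
  assumes "q permutes {1..n}" shows "inj (perm_right q)"
  unfolding perm_right_def
  by (rule injI, rule ext) (metis comp_apply option.inj_map permutes_inj[OF assms] injD)

lemma perm_left_IS:
  assumes p: "p permutes {1..n}" and \<alpha>: "\<alpha> \<in> IS n"
  shows "perm_left p \<alpha> \<in> IS n"
proof -
  have "inj_on (\<alpha> \<circ> p) (dom (\<alpha> \<circ> p))"
  proof (rule inj_onI)
    fix x y assume "x \<in> dom (\<alpha> \<circ> p)" "y \<in> dom (\<alpha> \<circ> p)" "(\<alpha> \<circ> p) x = (\<alpha> \<circ> p) y"
    then have "p x = p y" using \<alpha> by (auto simp: IS_iff inj_on_def dom_def)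
    then show "x = y" using permutes_inj[OF p] by (auto dest: injD)
  qed
  moreover have "dom (\<alpha> \<circ> p) \<subseteq> {1..n}"
  proof
    fix x assume "x \<in> dom (\<alpha> \<circ> p)"
    then have "p x \<in> {1..n}" using \<alpha> by (auto simp: IS_iff dom_def)
    then show "x \<in> {1..n}" using permutes_in_image[OF p] by blast
  qed
  moreover have "ran (\<alpha> \<circ> p) \<subseteq> {1..n}" using \<alpha> by (auto simp: IS_iff ran_def)
  ultimately show ?thesis by (simp add: IS_iff perm_left_def)
qed

lemma perm_right_IS:
  assumes q: "q permutes {1..n}" and \<alpha>: "\<alpha> \<in> IS n"
  shows "perm_right q \<alpha> \<in> IS n"
proof -
  have d: "dom (map_option q \<circ> \<alpha>) = dom \<alpha>" by (auto simp: dom_def)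
  have "inj (map_option q)" using permutes_inj[OF q] by (rule option.inj_map)
  then have "inj_on (map_option q \<circ> \<alpha>) (dom \<alpha>)"
    using \<alpha> by (auto simp: IS_iff intro: comp_inj_on inj_on_subset)
  moreover have "ran (map_option q \<circ> \<alpha>) \<subseteq> {1..n}"
  proof
    fix y assume "y \<in> ran (map_option q \<circ> \<alpha>)"
    then obtain z where "z \<in> ran \<alpha>" "y = q z" by (auto simp: ran_def)
    then show "y \<in> {1..n}" using \<alpha> permutes_in_image[OF q] by (auto simp: IS_iff)
  qed
  ultimately show ?thesis using d \<alpha> by (simp add: IS_iff perm_right_def)
qed

lemma map_pmf_unif:
  assumes "inj f" "\<And>\<alpha>. \<alpha> \<in> IS n \<Longrightarrow> f \<alpha> \<in> IS n"
  shows "map_pmf f (pmf_of_set (IS n)) = pmf_of_set (IS n)"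
proof -
  have "inj_on f (IS n)" using assms(1) by (rule inj_on_subset) simp
  moreover have "f ` IS n = IS n"
    using endo_inj_surj[OF finite_IS, of f n] calculation assms(2) by blast
  ultimately show ?thesis
    using map_pmf_of_set_inj[of f "IS n"] finite_IS IS_nonempty by metis
qed

definition prod_pmf_IS :: "nat \<Rightarrow> nat \<Rightarrow> (nat \<rightharpoonup> nat) pmf" where
  "prod_pmf_IS k n = map_pmf (IS_prod n) (replicate_pmf k (pmf_of_set (IS n)))"

lemma prod_prob_pmf: "prod_prob k n \<alpha> = pmf (prod_pmf_IS k n) \<alpha>"
  by (simp add: prod_prob_def prod_pmf_IS_def pmf_map vimage_def)

lemma prod_pmf_IS_Suc:
  "prod_pmf_IS (Suc k) n =
     bind_pmf (pmf_of_set (IS n)) (\<lambda>x. map_pmf (pmult x) (prod_pmf_IS k n))"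
  by (simp add: prod_pmf_IS_def IS_prod_def map_pmf_def bind_return_pmf bind_assoc_pmf)

lemma prod_pmf_IS_1: "prod_pmf_IS 1 n = pmf_of_set (IS n)"
proof -
  have "prod_pmf_IS 1 n = map_pmf (\<lambda>x. pmult x (IS_one n)) (pmf_of_set (IS n))"
    using prod_pmf_IS_Suc[of 0 n] by (simp add: prod_pmf_IS_def IS_prod_def map_pmf_def bind_return_pmf)
  also have "\<dots> = map_pmf (\<lambda>x. x) (pmf_of_set (IS n))"
    by (rule map_pmf_cong)
      (auto simp: pmult_IS_one set_pmf_of_set[OF IS_nonempty finite_IS])
  finally show ?thesis by simp
qed

lemma prod_pmf_perm_left:
  assumes p: "p permutes {1..n}" and k: "k > 0"
  shows "map_pmf (perm_left p) (prod_pmf_IS k n) = prod_pmf_IS k n"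
proof -
  obtain k' where k': "k = Suc k'" using k gr0_implies_Suc by blast
  let ?U = "pmf_of_set (IS n)"
  have "map_pmf (perm_left p) (prod_pmf_IS k n) =
      bind_pmf ?U (\<lambda>x. map_pmf (\<lambda>y. pmult (perm_left p x) y) (prod_pmf_IS k' n))"
    by (simp add: k' prod_pmf_IS_Suc map_bind_pmf map_pmf_comp pmult_perm_left)
  also have "\<dots> = bind_pmf (map_pmf (perm_left p) ?U)
      (\<lambda>x. map_pmf (pmult x) (prod_pmf_IS k' n))"
    by (simp add: bind_map_pmf)
  also have "map_pmf (perm_left p) ?U = ?U"
    using inj_perm_left[OF p] perm_left_IS[OF p] by (rule map_pmf_unif)
  finally show ?thesis by (simp add: k' prod_pmf_IS_Suc)
qed

lemma prod_pmf_perm_right: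
  assumes q: "q permutes {1..n}" and k: "k > 0"
  shows "map_pmf (perm_right q) (prod_pmf_IS k n) = prod_pmf_IS k n"
  using k
proof (induction k rule: nat_induct_non_zero)
  case 1
  show ?case unfolding prod_pmf_IS_1
    using inj_perm_right[OF q] perm_right_IS[OF q] by (rule map_pmf_unif)
next
  case (Suc k)
  have "map_pmf (perm_right q) (prod_pmf_IS (Suc k) n) =
      bind_pmf (pmf_of_set (IS n))
        (\<lambda>x. map_pmf (pmult x) (map_pmf (perm_right q) (prod_pmf_IS k n)))"
    by (simp add: prod_pmf_IS_Suc map_bind_pmf map_pmf_comp pmult_perm_right)
  then show ?case by (simp add: Suc.IH prod_pmf_IS_Suc)
qed

lemma extend_bij_permutes:
  assumes S: "finite S" "A \<subseteq> S" "B \<subseteq> S" and f: "bij_betw f A B"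
  shows "\<exists>p. p permutes S \<and> (\<forall>x\<in>A. p x = f x)"
proof -
  have "card (S - A) = card (S - B)"
    using S bij_betw_same_card[OF f] by (simp add: card_Diff_subset finite_subset[OF _ S(1)])
  then obtain g where g: "bij_betw g (S - A) (S - B)"
    using finite_same_card_bij[of "S - A" "S - B"] S(1) by auto
  define p where "p x = (if x \<in> A then f x else if x \<in> S then g x else x)" for x
  have "bij_betw p A B" using f by (rule bij_betw_cong[THEN iffD1, rotated]) (simp add: p_def)
  moreover have "bij_betw p (S - A) (S - B)"
    using g by (rule bij_betw_cong[THEN iffD1, rotated]) (simp add: p_def)
  ultimately have "bij_betw p (A \<union> (S - A)) (B \<union> (S - B))"
    by (rule bij_betw_combine) auto
  then have "bij_betw p S S" using S by (simp add: Un_absorb1)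
  moreover have "p x = x" if "x \<notin> S" for x using that S by (auto simp: p_def)
  ultimately have "p permutes S" by (rule bij_imp_permutes)
  then show ?thesis by (auto simp: p_def)
qed

lemma bij_betw_the: "\<alpha> \<in> IS n \<Longrightarrow> bij_betw (the \<circ> \<alpha>) (dom \<alpha>) (ran \<alpha>)"
  by (force simp: IS_iff bij_betw_def inj_on_def dom_def ran_def image_def)

lemma same_rank_perm:
  assumes \<alpha>: "\<alpha> \<in> IS n" and \<beta>: "\<beta> \<in> IS n" and r: "map_rank \<alpha> = map_rank \<beta>"
  shows "\<exists>p q. p permutes {1..n} \<and> q permutes {1..n} \<and> \<beta> = perm_right q (perm_left p \<alpha>)"
proof -
  have sub: "dom \<alpha> \<subseteq> {1..n}" "dom \<beta> \<subseteq> {1..n}" "ran \<alpha> \<subseteq> {1..n}" "ran \<beta> \<subseteq> {1..n}"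
    using \<alpha> \<beta> by (auto simp: IS_iff)
  then have "finite (dom \<alpha>)" "finite (dom \<beta>)" by (auto intro: finite_subset)
  then obtain f where f: "bij_betw f (dom \<beta>) (dom \<alpha>)"
    using r finite_same_card_bij unfolding map_rank_def by metis
  obtain p where p: "p permutes {1..n}" "\<forall>x\<in>dom \<beta>. p x = f x"
    using extend_bij_permutes[OF _ sub(2,1) f] by auto
  have pf: "bij_betw p (dom \<beta>) (dom \<alpha>)"
    using f by (rule bij_betw_cong[THEN iffD1, rotated]) (simp add: p)
  define h where "h = (the \<circ> \<alpha>) \<circ> p"
  have h: "bij_betw h (dom \<beta>) (ran \<alpha>)"
    unfolding h_def by (rule bij_betw_trans[OF pf bij_betw_the[OF \<alpha>]])
  have "bij_betw ((the \<circ> \<beta>) \<circ> inv_into (dom \<beta>) h) (ran \<alpha>) (ran \<beta>)"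
    by (rule bij_betw_trans[OF bij_betw_inv_into[OF h] bij_betw_the[OF \<beta>]])
  from extend_bij_permutes[OF _ sub(3,4) this] obtain q where
    q: "q permutes {1..n}" "\<forall>y\<in>ran \<alpha>. q y = the (\<beta> (inv_into (dom \<beta>) h y))" by auto
  have "\<beta> x = perm_right q (perm_left p \<alpha>) x" for x
  proof (cases "x \<in> dom \<beta>")
    case True
    then have "p x \<in> dom \<alpha>" using bij_betwE[OF pf] by blast
    then have ax: "\<alpha> (p x) = Some (h x)" by (auto simp: h_def)
    have "h x \<in> ran \<alpha>" using True bij_betwE[OF h] by blast
    moreover have "inv_into (dom \<beta>) h (h x) = x"
      using True bij_betw_imp_inj_on[OF h] by (rule inv_into_f_f[rotated])
    ultimately have "q (h x) = the (\<beta> x)" using q by auto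
    then show ?thesis using True ax by (auto simp: perm_right_def perm_left_def)
  next
    case False
    have "p x \<notin> dom \<alpha>"
    proof
      assume "p x \<in> dom \<alpha>"
      then have "p x \<in> p ` dom \<beta>" using bij_betw_imp_surj_on[OF pf] by simp
      then obtain y where "y \<in> dom \<beta>" "p y = p x" by (metis imageE)
      then show False using False permutes_inj[OF p(1)] by (auto dest: injD)
    qed
    then have "\<alpha> (p x) = None" by blast
    moreover have "\<beta> x = None" using False by blast
    ultimately show ?thesis by (simp add: perm_right_def perm_left_def)
  qed
  then show ?thesis using p(1) q(1) by blast
qed

lemma prod_prob_same_rank:
  assumes "\<alpha> \<in> IS n" "\<beta> \<in> IS n" "map_rank \<alpha> = map_rank \<beta>" "k > 0"
  shows "prod_prob k n \<alpha> = prod_prob k n \<beta>"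
proof -
  let ?M = "prod_pmf_IS k n"
  obtain p q where pq: "p permutes {1..n}" "q permutes {1..n}"
    "\<beta> = perm_right q (perm_left p \<alpha>)"
    using same_rank_perm[OF assms(1-3)] by blast
  have "pmf ?M \<beta> = pmf (map_pmf (perm_right q) ?M) (perm_right q (perm_left p \<alpha>))"
    using prod_pmf_perm_right[OF pq(2) assms(4)] pq(3) by simp
  also have "\<dots> = pmf ?M (perm_left p \<alpha>)"
    by (rule pmf_map_inj'[OF inj_perm_right[OF pq(2)]])
  also have "\<dots> = pmf (map_pmf (perm_left p) ?M) (perm_left p \<alpha>)"
    using prod_pmf_perm_left[OF pq(1) assms(4)] by simp
  also have "\<dots> = pmf ?M \<alpha>"
    by (rule pmf_map_inj'[OF inj_perm_left[OF pq(1)]])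
  finally show ?thesis by (simp add: prod_prob_pmf)
qed

lemma prod_prob_eq_P:
  assumes "\<alpha> \<in> IS n" "k > 0"
  shows "prod_prob k n \<alpha> = P k n (map_rank \<alpha>)"
  unfolding P_def
  by (rule the_equality[symmetric])
    (use assms prod_prob_same_rank in \<open>blast+\<close>)

end

theory Submission
  imports Defs
begin

text \<open>
  The matrix records one step of a recursion in the number of factors. Write a product of
  \<open>k + 1\<close> random factors as \<open>x \<cdot> \<beta>\<close>, where \<open>x\<close> is the first factor and
  \<open>\<beta>\<close> is the product of the remaining \<open>k\<close>. As \<open>x\<close> is uniform and independent of
  \<open>\<beta>\<close>, the probability of obtaining a given \<open>\<alpha>\<close> is
  \<open>1 / |IS n|\<close> times the sum over \<open>\<beta>\<close> of the number of solutions \<open>x\<close> of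
  \<open>x \<cdot> \<beta> = \<alpha>\<close>, weighted by the probability of \<open>\<beta>\<close> (\<open>prod_prob_Suc\<close>).
  That weight depends on the rank \<open>j\<close> of \<open>\<beta>\<close> only, so the sum can be
  collected by ranks. For \<open>\<alpha>\<close> of rank \<open>i\<close>, the coefficient of \<open>P k n j\<close> is then the
  number of pairs \<open>(x, \<beta>)\<close> with \<open>x \<cdot> \<beta> = \<alpha>\<close> and \<open>\<beta>\<close> of rank \<open>j\<close>, and it
  factorises.

  \<^item> A solution \<open>x\<close> exists exactly when the range of \<open>\<alpha>\<close> lies in the range of
  \<open>\<beta>\<close>. To choose such a \<open>\<beta>\<close>, enlarge the range of \<open>\<alpha>\<close> by \<open>j - i\<close> of the
  other \<open>n - i\<close> points, choose a domain of size \<open>j\<close>, and choose one of the \<open>j!\<close>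
  bijections between the two (\<open>card_rank_ran_superset\<close>).

  \<^item> Given \<open>\<beta>\<close>, the map \<open>x\<close> is forced on the domain of \<open>\<alpha>\<close>, where it is
  \<open>\<alpha> \<cdot> \<beta>\<inverse>\<close>. On the other \<open>n - i\<close> points it may be any partial injection into the
  \<open>n - j\<close> points that \<open>\<beta>\<close> does not accept (\<open>card_left_quotients\<close>).

  The product of these counts is the entry \<open>(i, j)\<close> of the transfer matrix. For a single factor
  all probabilities are \<open>1 / |IS n|\<close>, and induction on \<open>k\<close> gives the power of the matrix.
\<close>

section \<open>Partial injections between arbitrary finite sets\<close>

text \<open>Arbitrary sets are needed because the undetermined part of a solution \<open>x\<close> of
  \<open>x \<cdot> \<beta> = \<alpha>\<close> lives on complements of domains, which are not initial segments.\<close>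

definition pinj :: "'a set \<Rightarrow> 'b set \<Rightarrow> ('a \<rightharpoonup> 'b) set" where
  "pinj A B = {f. dom f \<subseteq> A \<and> ran f \<subseteq> B \<and> inj_on f (dom f)}"

lemma pinj_iff:
  "f \<in> pinj A B \<longleftrightarrow> (\<forall>x y. f x = Some y \<longrightarrow> x \<in> A \<and> y \<in> B) \<and>
     (\<forall>x x' y. f x = Some y \<longrightarrow> f x' = Some y \<longrightarrow> x = x')"
  unfolding pinj_def inj_on_def dom_def ran_def by auto

lemma pinj_mem:
  assumes "f \<in> pinj A B" "f x = Some y" shows "x \<in> A" "y \<in> B"
  using assms unfolding pinj_iff by blast+

lemma pinj_unique: "f \<in> pinj A B \<Longrightarrow> f x = Some y \<Longrightarrow> f x' = Some y \<Longrightarrow> x = x'"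
  unfolding pinj_iff by blast

lemma partial_injections_pinj: "partial_injections i j = pinj {1..i} {1..j}"
  by (simp add: partial_injections_def pinj_def)

lemma IS_pinj: "IS n = pinj {1..n} {1..n}"
  by (simp add: IS_def partial_injections_pinj)

lemma finite_pinj:
  assumes "finite A" "finite B" shows "finite (pinj A B)"
proof -
  have "pinj A B \<subseteq> (\<Union>D\<in>Pow A. {f. dom f = D \<and> ran f \<subseteq> B})"
    by (auto simp: pinj_def)
  moreover have "finite (\<Union>D\<in>Pow A. {f. dom f = D \<and> ran f \<subseteq> B})"
    using assms by (intro finite_UN_I) (auto intro!: finite_set_of_finite_maps intro: finite_subset)
  ultimately show ?thesis by (rule finite_subset)
qed

text \<open>Relabelling the points of the source by \<open>p\<close> and those of the target by \<open>q\<close> is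
  injective on partial injections. Only the inequality is shown here, since the
  reverse one comes from the inverse relabelling.\<close>

lemma card_pinj_le:
  fixes A :: "'a set" and B :: "'b set" and A' :: "'c set" and B' :: "'d set"
  assumes fin: "finite A'" "finite B'" and p: "bij_betw p A' A" and q: "bij_betw q B B'"
  shows "card (pinj A B) \<le> card (pinj A' B')"
proof (rule card_inj_on_le)
  let ?F = "\<lambda>f x. if x \<in> A' then map_option q (f (p x)) else None"
  show "finite (pinj A' B')" using fin by (rule finite_pinj)
  show "?F ` pinj A B \<subseteq> pinj A' B'"
  proof (rule image_subsetI)
    fix f assume f: "f \<in> pinj A B"
    show "?F f \<in> pinj A' B'"
      unfolding pinj_iff
    proof (intro conjI allI impI)
      fix x y assume "?F f x = Some y"
      then obtain z where "x \<in> A'" "f (p x) = Some z" "y = q z" by (auto split: if_splits)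
      then show "x \<in> A'" "y \<in> B'"
        using f bij_betwE[OF q] by (auto simp: pinj_iff)
    next
      fix x x' y assume "?F f x = Some y" "?F f x' = Some y"
      then obtain z z' where z: "x \<in> A'" "f (p x) = Some z" "y = q z"
        "x' \<in> A'" "f (p x') = Some z'" "y = q z'" by (auto split: if_splits)
      then have "z \<in> B" "z' \<in> B" using f by (auto simp: pinj_iff)
      then have "z = z'" using z bij_betw_imp_inj_on[OF q] by (auto dest: inj_onD)
      then have "p x = p x'" using z f by (auto simp: pinj_iff)
      then show "x = x'" using z bij_betw_imp_inj_on[OF p] by (auto dest: inj_onD)
    qed
  qed
  show "inj_on ?F (pinj A B)"
  proof (rule inj_onI, rule ext)
    fix f g a assume f: "f \<in> pinj A B" and g: "g \<in> pinj A B" and eq: "?F f = ?F g"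
    show "f a = g a"
    proof (cases "a \<in> A")
      case True
      then obtain x where x: "x \<in> A'" "a = p x"
        using bij_betw_imp_surj_on[OF p] by blast
      then have "map_option q (f a) = map_option q (g a)"
        using fun_cong[OF eq, of x] by simp
      moreover have "set_option (f a) \<subseteq> B" "set_option (g a) \<subseteq> B"
        using f g by (auto simp: pinj_iff)
      ultimately show ?thesis
        using bij_betw_imp_inj_on[OF q]
        by (cases "f a"; cases "g a") (auto dest: inj_onD)
    next
      case False
      then have "f a = None" "g a = None"
        using f g unfolding pinj_iff by (metis not_Some_eq)+
      then show ?thesis by simp
    qed
  qed
qed

lemma card_pinj:
  assumes "finite A" "finite B"
  shows "card (pinj A B) = num_partial_injections (card A) (card B)"
proof -
  obtain p where p: "bij_betw p {1..card A} A"
    using finite_same_card_bij[of "{1..card A}" A] assms by auto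
  obtain q where q: "bij_betw q {1..card B} B"
    using finite_same_card_bij[of "{1..card B}" B] assms by auto
  have "card (pinj A B) \<le> card (pinj {1..card A} {1..card B})"
    using p bij_betw_inv_into[OF q] by (intro card_pinj_le) auto
  moreover have "card (pinj {1..card A} {1..card B}) \<le> card (pinj A B)"
    using assms bij_betw_inv_into[OF p] q by (intro card_pinj_le) auto
  ultimately show ?thesis
    by (simp add: num_partial_injections_def partial_injections_pinj)
qed

section \<open>Solutions of \<open>x \<cdot> \<beta> = \<alpha>\<close>\<close>

lemma IS_dom_ran:
  assumes "\<alpha> \<in> IS n"
  shows "finite (dom \<alpha>)" "finite (ran \<alpha>)" "dom \<alpha> \<subseteq> {1..n}" "ran \<alpha> \<subseteq> {1..n}"
    "card (ran \<alpha>) = map_rank \<alpha>" "map_rank \<alpha> \<le> n"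
proof -
  show d: "dom \<alpha> \<subseteq> {1..n}" and r: "ran \<alpha> \<subseteq> {1..n}" using assms by (auto simp: IS_iff)
  show "finite (dom \<alpha>)" "finite (ran \<alpha>)" using d r by (auto intro: finite_subset)
  show "card (ran \<alpha>) = map_rank \<alpha>"
    unfolding map_rank_def using bij_betw_same_card[OF bij_betw_the[OF assms]] by simp
  show "map_rank \<alpha> \<le> n" unfolding map_rank_def using card_mono[OF _ d] by simp
qed

lemma pmult_IS:
  assumes "x \<in> IS n" "y \<in> IS n" shows "pmult x y \<in> IS n"
  using assms unfolding IS_pinj pinj_iff pmult_def map_comp_Some_iff by metis

lemma ran_pmult: "ran (pmult x y) \<subseteq> ran y"
  by (auto simp: ran_def pmult_def map_comp_Some_iff)

text \<open>A solution \<open>x\<close> must send each point \<open>z\<close> of the domain of \<open>\<alpha>\<close> to the unique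
  preimage of \<open>\<alpha> z\<close> under \<open>\<beta>\<close>, and must send every other point outside the domain of
  \<open>\<beta>\<close> if it is defined there at all. The forced part \<open>\<gamma>\<close> maps into the domain of \<open>\<beta>\<close>
  and the free part avoids it, so any partial injection between the complements can
  be glued to \<open>\<gamma>\<close> without losing injectivity.\<close>

lemma card_left_quotients:
  assumes \<alpha>: "\<alpha> \<in> IS n" and \<beta>: "\<beta> \<in> IS n" and sub: "ran \<alpha> \<subseteq> ran \<beta>"
  shows "card {x \<in> IS n. pmult x \<beta> = \<alpha>} =
    num_partial_injections (n - map_rank \<alpha>) (n - map_rank \<beta>)"
proof -
  let ?A = "{1..n} - dom \<alpha>" and ?B = "{1..n} - dom \<beta>"
  define \<gamma> where "\<gamma> z = (if z \<in> dom \<alpha> then Some (SOME y. \<beta> y = \<alpha> z) else None)" for z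
  have \<gamma>_dom: "dom \<gamma> = dom \<alpha>" by (auto simp: \<gamma>_def split: if_splits)
  have \<gamma>_\<beta>: "\<beta> y = \<alpha> z" "z \<in> dom \<alpha>" if "\<gamma> z = Some y" for y z
  proof -
    show z: "z \<in> dom \<alpha>" using that by (auto simp: \<gamma>_def split: if_splits)
    then obtain w where "\<alpha> z = Some w" "w \<in> ran \<beta>" using sub by (auto intro: ranI)
    then have "\<exists>y. \<beta> y = \<alpha> z" by (auto simp: ran_def)
    then have "\<beta> (SOME y. \<beta> y = \<alpha> z) = \<alpha> z" by (rule someI_ex)
    then show "\<beta> y = \<alpha> z" using z that by (simp add: \<gamma>_def)
  qed
  have \<gamma>_uniq: "\<gamma> z = Some y" if \<beta>y: "\<beta> y = \<alpha> z" and dz: "z \<in> dom \<alpha>" for y z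
  proof -
    have "z \<in> dom \<gamma>" using dz \<gamma>_dom by simp
    then obtain y' where y': "\<gamma> z = Some y'" using domD by metis
    obtain w where w: "\<alpha> z = Some w" using domD[OF dz] by blast
    have "\<beta> y' = Some w" "\<beta> y = Some w" using \<gamma>_\<beta>(1)[OF y'] \<beta>y w by simp_all
    then have "y' = y" by (rule pinj_unique[OF \<beta>[unfolded IS_pinj]])
    then show ?thesis using y' by simp
  qed
  have "bij_betw (\<lambda>f. f ++ \<gamma>) (pinj ?A ?B) {x \<in> IS n. pmult x \<beta> = \<alpha>}"
  proof (rule bij_betw_byWitness[where f' = "\<lambda>x. x |` (- dom \<alpha>)"])
    show "\<forall>f\<in>pinj ?A ?B. (f ++ \<gamma>) |` (- dom \<alpha>) = f"
    proof (intro ballI ext)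
      fix f z assume f: "f \<in> pinj ?A ?B"
      have "z \<in> dom \<alpha> \<Longrightarrow> f z = None" using f by (auto simp: pinj_def)
      moreover have "z \<notin> dom \<alpha> \<Longrightarrow> \<gamma> z = None" using \<gamma>_dom by auto
      ultimately show "((f ++ \<gamma>) |` (- dom \<alpha>)) z = f z"
        by (cases "z \<in> dom \<alpha>") (auto simp: restrict_map_def map_add_def)
    qed
    show "\<forall>x\<in>{x \<in> IS n. pmult x \<beta> = \<alpha>}. x |` (- dom \<alpha>) ++ \<gamma> = x"
    proof (intro ballI ext)
      fix x z assume "x \<in> {x \<in> IS n. pmult x \<beta> = \<alpha>}"
      then have x: "pmult x \<beta> = \<alpha>" by simp
      show "(x |` (- dom \<alpha>) ++ \<gamma>) z = x z"
      proof (cases "z \<in> dom \<alpha>")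
        case True
        then obtain y where "x z = Some y" "\<beta> y = \<alpha> z"
          using x by (auto simp: pmult_def map_comp_Some_iff)
        then show ?thesis using \<gamma>_uniq[of y z] True by simp
      next
        case False
        then have "\<gamma> z = None" using \<gamma>_dom by auto
        then show ?thesis using False by (simp add: map_add_def)
      qed
    qed
    show "(\<lambda>f. f ++ \<gamma>) ` pinj ?A ?B \<subseteq> {x \<in> IS n. pmult x \<beta> = \<alpha>}"
    proof (rule image_subsetI)
      fix f assume f: "f \<in> pinj ?A ?B"
      have \<gamma>_img: "y \<in> dom \<beta>" if "\<gamma> z = Some y" for y z using \<gamma>_\<beta>[OF that] by auto
      have \<gamma>_IS: "\<gamma> \<in> pinj (dom \<alpha>) (dom \<beta>)"
        unfolding pinj_iff
      proof (intro conjI allI impI)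
        fix z y assume "\<gamma> z = Some y"
        then show "z \<in> dom \<alpha>" "y \<in> dom \<beta>" using \<gamma>_\<beta> \<gamma>_img by auto
      next
        fix z z' y assume "\<gamma> z = Some y" "\<gamma> z' = Some y"
        then have z: "\<alpha> z = \<beta> y" "\<alpha> z' = \<beta> y" "z \<in> dom \<alpha>"
          using \<gamma>_\<beta>[of z y] \<gamma>_\<beta>[of z' y] by simp_all
        obtain w where "\<alpha> z = Some w" using domD[OF z(3)] by blast
        moreover from this have "\<alpha> z' = Some w" using z by simp
        ultimately show "z = z'" by (rule pinj_unique[OF \<alpha>[unfolded IS_pinj]])
      qed
      have "f ++ \<gamma> \<in> IS n"
        unfolding IS_pinj pinj_iff
      proof (intro conjI allI impI)
        fix z y assume "(f ++ \<gamma>) z = Some y"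
        then have "f z = Some y \<or> \<gamma> z = Some y" by auto
        then have "z \<in> ?A \<union> dom \<alpha>" "y \<in> ?B \<union> dom \<beta>"
          using pinj_mem[OF f, of z y] pinj_mem[OF \<gamma>_IS, of z y] by blast+
        then show "z \<in> {1..n}" "y \<in> {1..n}"
          using IS_dom_ran(3)[OF \<alpha>] IS_dom_ran(3)[OF \<beta>] by blast+
      next
        fix z z' y assume "(f ++ \<gamma>) z = Some y" "(f ++ \<gamma>) z' = Some y"
        then have "f z = Some y \<or> \<gamma> z = Some y" "f z' = Some y \<or> \<gamma> z' = Some y" by auto
        then show "z = z'"
          using pinj_mem(2)[OF f] pinj_mem(2)[OF \<gamma>_IS] pinj_unique[OF f] pinj_unique[OF \<gamma>_IS]
          by (metis DiffD2)
      qed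
      moreover have "pmult (f ++ \<gamma>) \<beta> = \<alpha>"
      proof
        fix z
        show "pmult (f ++ \<gamma>) \<beta> z = \<alpha> z"
        proof (cases "z \<in> dom \<alpha>")
          case True
          then have "z \<in> dom \<gamma>" using \<gamma>_dom by simp
          then obtain y where "\<gamma> z = Some y" using domD by metis
          then show ?thesis using \<gamma>_\<beta> by (simp add: pmult_def map_comp_def)
        next
          case False
          then have "\<gamma> z = None" "\<alpha> z = None" using \<gamma>_dom by auto
          moreover have "\<beta> y = None" if "f z = Some y" for y
            using f that by (auto simp: pinj_iff)
          ultimately show ?thesis
            by (auto simp: pmult_def map_comp_def map_add_def split: option.splits)
        qed
      qed
      ultimately show "f ++ \<gamma> \<in> {x \<in> IS n. pmult x \<beta> = \<alpha>}" by simp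
    qed
    show "(\<lambda>x. x |` (- dom \<alpha>)) ` {x \<in> IS n. pmult x \<beta> = \<alpha>} \<subseteq> pinj ?A ?B"
    proof (rule image_subsetI)
      fix x assume "x \<in> {x \<in> IS n. pmult x \<beta> = \<alpha>}"
      then have x: "x \<in> pinj {1..n} {1..n}" "pmult x \<beta> = \<alpha>" by (auto simp: IS_pinj)
      have "y \<notin> dom \<beta>" if "x z = Some y" "z \<notin> dom \<alpha>" for y z
        using that x(2) by (auto simp: pmult_def map_comp_def)
      then show "x |` (- dom \<alpha>) \<in> pinj ?A ?B"
        using x(1) by (auto simp: pinj_iff restrict_map_def split: if_splits)
    qed
  qed
  from bij_betw_same_card[OF this]
  have "card {x \<in> IS n. pmult x \<beta> = \<alpha>} = card (pinj ?A ?B)" by (rule sym)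
  also have "\<dots> = num_partial_injections (n - map_rank \<alpha>) (n - map_rank \<beta>)"
    using IS_dom_ran[OF \<alpha>] IS_dom_ran[OF \<beta>]
    by (simp add: card_pinj card_Diff_subset map_rank_def)
  finally show ?thesis .
qed

section \<open>Factors \<open>\<beta>\<close> of a given rank\<close>

text \<open>After fixing one bijection \<open>h\<close> from \<open>D\<close> to \<open>R\<close>, every other one is \<open>h\<close> followed
  by a unique permutation of \<open>R\<close>.\<close>

lemma card_bijections_as_maps:
  assumes fin: "finite D" "finite R" and card: "card D = card R"
  shows "card {\<beta>. dom \<beta> = D \<and> ran \<beta> = R \<and> inj_on \<beta> (dom \<beta>)} = fact (card R)"
proof -
  obtain h where h: "bij_betw h D R" using finite_same_card_bij[OF fin card] by auto
  let ?F = "\<lambda>p x. if x \<in> D then Some (p (h x)) else None"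
  let ?S = "{\<beta>. dom \<beta> = D \<and> ran \<beta> = R \<and> inj_on \<beta> (dom \<beta>)}"
  have hD: "h ` D = R" using h by (rule bij_betw_imp_surj_on)
  have "inj_on ?F {p. p permutes R}"
  proof (rule inj_onI, rule ext)
    fix p p' r assume pp: "p \<in> {p. p permutes R}" "p' \<in> {p. p permutes R}" and eq: "?F p = ?F p'"
    show "p r = p' r"
    proof (cases "r \<in> R")
      case True
      then obtain x where "x \<in> D" "r = h x" using hD by blast
      then show ?thesis using fun_cong[OF eq, of x] by simp
    next
      case False
      then show ?thesis using pp by (simp add: permutes_not_in)
    qed
  qed
  moreover have "?F ` {p. p permutes R} = ?S"
  proof (intro equalityI subsetI)
    fix \<beta> assume "\<beta> \<in> ?F ` {p. p permutes R}"
    then obtain p where p: "p permutes R" "\<beta> = ?F p" by blast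
    have d: "dom \<beta> = D" unfolding p(2) by (auto simp: dom_def)
    have "ran \<beta> = p ` h ` D" unfolding p(2) by (auto simp: ran_def)
    then have "ran \<beta> = R" using hD permutes_image[OF p(1)] by simp
    moreover have "inj_on \<beta> (dom \<beta>)" unfolding d p(2)
      using permutes_inj[OF p(1)] bij_betw_imp_inj_on[OF h] by (simp add: inj_on_def dom_def)
    ultimately show "\<beta> \<in> ?S" using d by simp
  next
    fix \<beta> assume "\<beta> \<in> ?S"
    then have b: "dom \<beta> = D" "ran \<beta> = R" "inj_on \<beta> D" by auto
    define g where "g = inv_into D h"
    have g: "bij_betw g R D" unfolding g_def using h by (rule bij_betw_inv_into)
    have "bij_betw (the \<circ> \<beta>) D R"
    proof (rule bij_betw_imageI)
      show "inj_on (the \<circ> \<beta>) D"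
      proof (rule inj_onI)
        fix x x' assume x: "x \<in> D" "x' \<in> D" "(the \<circ> \<beta>) x = (the \<circ> \<beta>) x'"
        then have "x \<in> dom \<beta>" "x' \<in> dom \<beta>" using b(1) by simp_all
        then have "\<beta> x = \<beta> x'" using x(3) by auto
        then show "x = x'" using inj_onD[OF b(3) _ x(1,2)] by blast
      qed
      show "(the \<circ> \<beta>) ` D = R" unfolding b(1,2)[symmetric] ran_def dom_def by force
    qed
    then have b2: "bij_betw ((the \<circ> \<beta>) \<circ> g) R R" by (rule bij_betw_trans[OF g])
    define p where "p r = (if r \<in> R then the (\<beta> (g r)) else r)" for r
    have "bij_betw p R R"
      using b2 by (rule bij_betw_cong[THEN iffD1, rotated]) (simp add: p_def)
    then have "p permutes R" by (rule bij_imp_permutes) (simp add: p_def)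
    moreover have "\<beta> = ?F p"
    proof
      fix x
      show "\<beta> x = ?F p x"
      proof (cases "x \<in> D")
        case True
        then have "g (h x) = x" unfolding g_def
          using bij_betw_imp_inj_on[OF h] by simp
        moreover have "h x \<in> R" using True hD by blast
        moreover obtain y where "\<beta> x = Some y" using True b by blast
        ultimately show ?thesis using True by (simp add: p_def)
      next
        case False
        then show ?thesis using b by auto
      qed
    qed
    ultimately show "\<beta> \<in> ?F ` {p. p permutes R}" by blast
  qed
  ultimately have "bij_betw ?F {p. p permutes R} ?S" by (rule bij_betw_imageI)
  from bij_betw_same_card[OF this] show ?thesis using card_permutations[OF refl fin(2)] by simp
qed

lemma card_supersets:
  assumes "finite S" "A \<subseteq> S" "card A \<le> j"
  shows "card {R. A \<subseteq> R \<and> R \<subseteq> S \<and> card R = j} = (card S - card A) choose (j - card A)"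
proof -
  have fA: "finite A" using assms finite_subset by blast
  have "bij_betw (\<lambda>T. A \<union> T) {T. T \<subseteq> S - A \<and> card T = j - card A}
      {R. A \<subseteq> R \<and> R \<subseteq> S \<and> card R = j}"
  proof (rule bij_betw_byWitness[where f' = "\<lambda>R. R - A"])
    show "(\<lambda>T. A \<union> T) ` {T. T \<subseteq> S - A \<and> card T = j - card A}
        \<subseteq> {R. A \<subseteq> R \<and> R \<subseteq> S \<and> card R = j}"
    proof (rule image_subsetI)
      fix T assume "T \<in> {T. T \<subseteq> S - A \<and> card T = j - card A}"
      then have T: "T \<subseteq> S - A" "card T = j - card A" by auto
      then have "finite T" using assms(1) finite_subset by blast
      then have "card (A \<union> T) = card A + card T" using T fA by (intro card_Un_disjoint) auto
      then show "A \<union> T \<in> {R. A \<subseteq> R \<and> R \<subseteq> S \<and> card R = j}" using T assms by auto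
    qed
    show "(\<lambda>R. R - A) ` {R. A \<subseteq> R \<and> R \<subseteq> S \<and> card R = j}
        \<subseteq> {T. T \<subseteq> S - A \<and> card T = j - card A}"
    proof (rule image_subsetI)
      fix R assume "R \<in> {R. A \<subseteq> R \<and> R \<subseteq> S \<and> card R = j}"
      then show "R - A \<in> {T. T \<subseteq> S - A \<and> card T = j - card A}"
        using fA card_Diff_subset[of A R] by blast
    qed
    show "\<forall>T\<in>{T. T \<subseteq> S - A \<and> card T = j - card A}. (A \<union> T) - A = T" by blast
    show "\<forall>R\<in>{R. A \<subseteq> R \<and> R \<subseteq> S \<and> card R = j}. A \<union> (R - A) = R" by blast
  qed
  from bij_betw_same_card[OF this]
  have "card {R. A \<subseteq> R \<and> R \<subseteq> S \<and> card R = j} = card {T. T \<subseteq> S - A \<and> card T = j - card A}"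
    by (rule sym)
  then show ?thesis using assms fA by (simp add: n_subsets card_Diff_subset)
qed

text \<open>An element of \<open>IS n\<close> amounts to a domain, a range of the same size and a bijection
  between them, so the count is a product over these three choices. In the application
  \<open>A\<close> is the range of \<open>\<alpha>\<close>.\<close>

lemma card_rank_ran_superset:
  assumes A: "A \<subseteq> {1..n}" "card A \<le> j"
  shows "card {\<beta> \<in> IS n. map_rank \<beta> = j \<and> A \<subseteq> ran \<beta>} =
    ((n - card A) choose (j - card A)) * (n choose j) * fact j"
proof -
  define Ds where "Ds = {D. D \<subseteq> {1..n} \<and> card D = j}"
  define Rs where "Rs = {R. A \<subseteq> R \<and> R \<subseteq> {1..n} \<and> card R = j}"
  define F :: "nat set \<times> nat set \<Rightarrow> (nat \<rightharpoonup> nat) set"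
    where "F t = {\<beta>. dom \<beta> = fst t \<and> ran \<beta> = snd t \<and> inj_on \<beta> (dom \<beta>)}" for t
  have fin: "finite (Ds \<times> Rs)" by (simp add: Ds_def Rs_def)
  have cF: "card (F t) = fact j" if "t \<in> Ds \<times> Rs" for t
  proof -
    have "fst t \<subseteq> {1..n}" "snd t \<subseteq> {1..n}" and c: "card (fst t) = j" "card (snd t) = j"
      using that by (auto simp: Ds_def Rs_def)
    then have "finite (fst t)" "finite (snd t)" by (auto intro: finite_subset)
    with c have "card (fst t) = card (snd t)" "finite (fst t)" "finite (snd t)" "card (snd t) = j"
      by simp_all
    then show ?thesis unfolding F_def by (simp add: card_bijections_as_maps)
  qed
  have "{\<beta> \<in> IS n. map_rank \<beta> = j \<and> A \<subseteq> ran \<beta>} = (\<Union>t\<in>Ds \<times> Rs. F t)"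
  proof (intro equalityI subsetI)
    fix \<beta> assume "\<beta> \<in> {\<beta> \<in> IS n. map_rank \<beta> = j \<and> A \<subseteq> ran \<beta>}"
    then have b: "\<beta> \<in> IS n" "map_rank \<beta> = j" "A \<subseteq> ran \<beta>" by auto
    then have "(dom \<beta>, ran \<beta>) \<in> Ds \<times> Rs" "\<beta> \<in> F (dom \<beta>, ran \<beta>)"
      using IS_dom_ran[OF b(1)] by (auto simp: Ds_def Rs_def F_def map_rank_def IS_iff)
    then show "\<beta> \<in> (\<Union>t\<in>Ds \<times> Rs. F t)" by blast
  next
    fix \<beta> assume "\<beta> \<in> (\<Union>t\<in>Ds \<times> Rs. F t)"
    then show "\<beta> \<in> {\<beta> \<in> IS n. map_rank \<beta> = j \<and> A \<subseteq> ran \<beta>}"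
      by (auto simp: Ds_def Rs_def F_def map_rank_def IS_iff)
  qed
  also have "card (\<Union>t\<in>Ds \<times> Rs. F t) = (\<Sum>t\<in>Ds \<times> Rs. card (F t))"
  proof (rule card_UN_disjoint[OF fin])
    show "\<forall>t\<in>Ds \<times> Rs. finite (F t)"
    proof
      fix t assume "t \<in> Ds \<times> Rs"
      then have "card (F t) \<noteq> 0" using cF by simp
      then show "finite (F t)" by (metis card.infinite)
    qed
    show "\<forall>s\<in>Ds \<times> Rs. \<forall>t\<in>Ds \<times> Rs. s \<noteq> t \<longrightarrow> F s \<inter> F t = {}"
      by (auto simp: F_def)
  qed
  also have "\<dots> = card Ds * card Rs * fact j" using cF by (simp add: card_cartesian_product)
  also have "card Ds = n choose j" unfolding Ds_def by (simp add: n_subsets)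
  also have "card Rs = (n - card A) choose (j - card A)"
    unfolding Rs_def using card_supersets[OF _ A] by simp
  finally show ?thesis by (simp add: mult_ac)
qed

section \<open>The recursion for the probabilities\<close>

lemma set_prod_pmf_IS:
  assumes "k > 0" shows "set_pmf (prod_pmf_IS k n) \<subseteq> IS n"
  using assms
proof (induction k rule: nat_induct_non_zero)
  case 1
  show ?case unfolding prod_pmf_IS_1 by (simp add: set_pmf_of_set[OF IS_nonempty finite_IS])
next
  case (Suc k)
  then show ?case
    by (auto simp: prod_pmf_IS_Suc set_pmf_of_set[OF IS_nonempty finite_IS] intro!: pmult_IS)
qed

text \<open>Conditioning on the first factor gives a sum over \<open>x\<close> of the probability that the
  remaining product \<open>\<beta>\<close> satisfies \<open>x \<cdot> \<beta> = \<alpha>\<close>; exchanging the two sums counts the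
  solutions \<open>x\<close> for each \<open>\<beta>\<close>.\<close>

lemma prod_prob_Suc:
  assumes "k > 0"
  shows "prod_prob (Suc k) n \<alpha> =
    (\<Sum>\<beta>\<in>IS n. real (card {x \<in> IS n. pmult x \<beta> = \<alpha>}) * prod_prob k n \<beta>) / real (card (IS n))"
proof -
  let ?M = "prod_pmf_IS k n"
  have step: "pmf (map_pmf (pmult x) ?M) \<alpha> =
      (\<Sum>\<beta>\<in>IS n. if pmult x \<beta> = \<alpha> then pmf ?M \<beta> else 0)" for x
  proof -
    have "pmf (map_pmf (pmult x) ?M) \<alpha> = measure ?M (pmult x -` {\<alpha>})" by (rule pmf_map)
    also have "\<dots> = measure ?M ((pmult x -` {\<alpha>} \<inter> IS n) \<inter> set_pmf ?M)"
      using set_prod_pmf_IS[OF assms, of n]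
      by (subst measure_Int_set_pmf[symmetric]) (rule arg_cong[of _ _ "measure ?M"], blast)
    also have "\<dots> = measure ?M (pmult x -` {\<alpha>} \<inter> IS n)" by (rule measure_Int_set_pmf)
    also have "\<dots> = (\<Sum>\<beta>\<in>pmult x -` {\<alpha>} \<inter> IS n. pmf ?M \<beta>)"
      by (rule measure_measure_pmf_finite) (simp add: finite_IS)
    also have "\<dots> = (\<Sum>\<beta>\<in>IS n. if pmult x \<beta> = \<alpha> then pmf ?M \<beta> else 0)"
      by (rule sum.mono_neutral_cong_left) (auto simp: finite_IS)
    finally show ?thesis .
  qed
  have "prod_prob (Suc k) n \<alpha> =
      (\<Sum>x\<in>IS n. pmf (map_pmf (pmult x) ?M) \<alpha>) / real (card (IS n))"
    unfolding prod_prob_pmf prod_pmf_IS_Suc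
    by (rule pmf_bind_pmf_of_set[OF IS_nonempty finite_IS])
  also have "(\<Sum>x\<in>IS n. pmf (map_pmf (pmult x) ?M) \<alpha>) =
      (\<Sum>\<beta>\<in>IS n. \<Sum>x\<in>IS n. if pmult x \<beta> = \<alpha> then pmf ?M \<beta> else 0)"
    unfolding step by (rule sum.swap)
  also have "\<dots> = (\<Sum>\<beta>\<in>IS n. real (card {x \<in> IS n. pmult x \<beta> = \<alpha>}) * prod_prob k n \<beta>)"
    by (simp add: sum.If_cases finite_IS prod_prob_pmf Int_def)
  finally show ?thesis .
qed

text \<open>The inner sums over all \<open>\<beta>\<close> of one rank have constant summands on those \<open>\<beta>\<close> whose
  range contains that of \<open>\<alpha>\<close> and vanish elsewhere. For \<open>j < i\<close> no range is large enough,
  which is why the matrix is upper triangular.\<close>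

lemma P_Suc:
  assumes k: "k > 0" and i: "i \<le> n"
  shows "P (Suc k) n i = (\<Sum>j\<le>n. transfer_matrix n $$ (i, j) * P k n j) / real (card (IS n))"
proof -
  obtain \<alpha> where \<alpha>: "\<alpha> \<in> IS n" and r: "map_rank \<alpha> = i" using ex_rank[OF i] by blast
  let ?I = "\<lambda>j. num_partial_injections (n - i) (n - j)"
  let ?q = "\<lambda>\<beta>. real (card {x \<in> IS n. pmult x \<beta> = \<alpha>})"
  have q: "?q \<beta> = (if ran \<alpha> \<subseteq> ran \<beta> then real (?I (map_rank \<beta>)) else 0)" if "\<beta> \<in> IS n" for \<beta>
  proof (cases "ran \<alpha> \<subseteq> ran \<beta>")
    case True
    then show ?thesis using card_left_quotients[OF \<alpha> that] r by simp
  next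
    case False
    then have "{x \<in> IS n. pmult x \<beta> = \<alpha>} = {}" using ran_pmult by blast
    then have "card {x \<in> IS n. pmult x \<beta> = \<alpha>} = 0" by (metis card.empty)
    then show ?thesis using False by simp
  qed
  have row: "(\<Sum>\<beta>\<in>{\<beta> \<in> IS n. map_rank \<beta> = j}. ?q \<beta> * prod_prob k n \<beta>) =
      transfer_matrix n $$ (i, j) * P k n j" if j: "j \<le> n" for j
  proof -
    let ?T = "{\<beta> \<in> IS n. map_rank \<beta> = j \<and> ran \<alpha> \<subseteq> ran \<beta>}"
    have "(\<Sum>\<beta>\<in>{\<beta> \<in> IS n. map_rank \<beta> = j}. ?q \<beta> * prod_prob k n \<beta>) =
        (\<Sum>\<beta>\<in>?T. real (?I j) * P k n j)"
      by (rule sum.mono_neutral_cong_right) (auto simp: finite_IS q prod_prob_eq_P[OF _ k])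
    also have "\<dots> = real (card ?T * ?I j) * P k n j" by simp
    also have "real (card ?T * ?I j) = transfer_matrix n $$ (i, j)"
    proof (cases "i \<le> j")
      case True
      have "card ?T = ((n - i) choose (j - i)) * (n choose j) * fact j"
        using card_rank_ran_superset[of "ran \<alpha>" n j] IS_dom_ran[OF \<alpha>] r True by simp
      then show ?thesis using True i j by (simp add: transfer_matrix_def)
    next
      case False
      have "?T = {}"
      proof (rule ccontr)
        assume "?T \<noteq> {}"
        then obtain \<beta> where "\<beta> \<in> IS n" "map_rank \<beta> = j" "ran \<alpha> \<subseteq> ran \<beta>" by blast
        then have "i \<le> j"
          using card_mono[of "ran \<beta>" "ran \<alpha>"] IS_dom_ran[of \<beta> n] IS_dom_ran[OF \<alpha>] r by simp
        then show False using False by simp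
      qed
      then have "card ?T = 0" by (metis card.empty)
      then show ?thesis using False i j by (simp add: transfer_matrix_def)
    qed
    finally show ?thesis .
  qed
  have "(\<Sum>\<beta>\<in>IS n. ?q \<beta> * prod_prob k n \<beta>) =
      (\<Sum>j\<le>n. \<Sum>\<beta>\<in>{\<beta> \<in> IS n. map_rank \<beta> = j}. ?q \<beta> * prod_prob k n \<beta>)"
    by (rule sum.group[symmetric]) (auto simp: finite_IS IS_dom_ran(6))
  also have "\<dots> = (\<Sum>j\<le>n. transfer_matrix n $$ (i, j) * P k n j)"
    using row by (intro sum.cong) auto
  finally have "prod_prob (Suc k) n \<alpha> =
      (\<Sum>j\<le>n. transfer_matrix n $$ (i, j) * P k n j) / real (card (IS n))"
    by (simp add: prod_prob_Suc[OF k])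
  then show ?thesis using prod_prob_eq_P[OF \<alpha>, of "Suc k"] r by simp
qed

lemma P_1:
  assumes "i \<le> n" shows "P 1 n i = 1 / real (card (IS n))"
proof -
  obtain \<alpha> where \<alpha>: "\<alpha> \<in> IS n" "map_rank \<alpha> = i" using ex_rank[OF assms] by blast
  then have "P 1 n i = prod_prob 1 n \<alpha>" using prod_prob_eq_P[of \<alpha> n 1] by simp
  also have "\<dots> = 1 / real (card (IS n))"
    unfolding prod_prob_pmf prod_pmf_IS_1
    using \<alpha> by (simp add: pmf_of_set[OF IS_nonempty finite_IS])
  finally show ?thesis .
qed

section \<open>Matrix form\<close>

text \<open>Powers of matrices are defined by multiplication on the right, whereas the recursion
  applies the new factor on the left.\<close>

lemma pow_mat_Suc_left:
  assumes A: "A \<in> carrier_mat m m" shows "A ^\<^sub>m Suc k = A * A ^\<^sub>m k"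
proof (induction k)
  case 0
  then show ?case using A by simp
next
  case (Suc k)
  have "A ^\<^sub>m Suc (Suc k) = (A * A ^\<^sub>m k) * A" using Suc by simp
  also have "\<dots> = A * A ^\<^sub>m Suc k"
    using A by (simp add: assoc_mult_mat[of _ m m _ m _ m])
  finally show ?case .
qed

lemma vec_P_Suc:
  assumes "k > 0"
  shows "Matrix.vec (n + 1) (\<lambda>i. P (Suc k) n i) =
    (1 / real (card (IS n))) \<cdot>\<^sub>v (transfer_matrix n *\<^sub>v Matrix.vec (n + 1) (\<lambda>i. P k n i))"
proof (rule eq_vecI)
  have dim: "dim_row (transfer_matrix n) = n + 1" "dim_col (transfer_matrix n) = n + 1"
    by (simp_all add: transfer_matrix_def)
  fix i assume "i < dim_vec ((1 / real (card (IS n))) \<cdot>\<^sub>v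
    (transfer_matrix n *\<^sub>v Matrix.vec (n + 1) (\<lambda>i. P k n i)))"
  then have i: "i < n + 1" by (simp add: dim)
  have "{..n} = {0..<n + 1}" by auto
  then show "Matrix.vec (n + 1) (\<lambda>i. P (Suc k) n i) $ i =
      ((1 / real (card (IS n))) \<cdot>\<^sub>v
        (transfer_matrix n *\<^sub>v Matrix.vec (n + 1) (\<lambda>i. P k n i))) $ i"
    using i P_Suc[OF assms, of i n] by (simp add: dim scalar_prod_def)
qed (simp add: transfer_matrix_def)

theorem theorem11:
  fixes n k :: nat
  assumes "n > 0" and "k > 0"
  shows "Matrix.vec (n + 1) (\<lambda>i. P k n i) =
    (1 / real (card (IS n)) ^ k) \<cdot>\<^sub>v
      ((transfer_matrix n ^\<^sub>m (k - 1)) *\<^sub>v Matrix.vec (n + 1) (\<lambda>_. 1))"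
  using assms(2)
proof (induction k rule: nat_induct_non_zero)
  case 1
  have "transfer_matrix n \<in> carrier_mat (n + 1) (n + 1)" by (simp add: transfer_matrix_def)
  then show ?case
    by (intro eq_vecI) (auto simp: P_1[simplified] transfer_matrix_def)
next
  case (Suc k)
  let ?A = "transfer_matrix n" and ?e = "Matrix.vec (n + 1) (\<lambda>_. 1 :: real)"
  let ?c = "real (card (IS n))"
  have A: "?A \<in> carrier_mat (n + 1) (n + 1)" by (simp add: transfer_matrix_def)
  have Ak: "?A ^\<^sub>m m \<in> carrier_mat (n + 1) (n + 1)" for m using A by (rule pow_carrier_mat)
  have e: "?e \<in> carrier_vec (n + 1)" by simp
  have "Matrix.vec (n + 1) (\<lambda>i. P (Suc k) n i) =
      (1 / ?c) \<cdot>\<^sub>v (?A *\<^sub>v ((1 / ?c ^ k) \<cdot>\<^sub>v (?A ^\<^sub>m (k - 1) *\<^sub>v ?e)))"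
    using vec_P_Suc[OF Suc.hyps] Suc.IH by simp
  also have "\<dots> = (1 / ?c ^ Suc k) \<cdot>\<^sub>v (?A *\<^sub>v (?A ^\<^sub>m (k - 1) *\<^sub>v ?e))"
    using mult_mat_vec[OF A mult_mat_vec_carrier[OF Ak e]] by (simp add: smult_smult_assoc)
  also have "?A *\<^sub>v (?A ^\<^sub>m (k - 1) *\<^sub>v ?e) = (?A ^\<^sub>m Suc (k - 1)) *\<^sub>v ?e"
    unfolding pow_mat_Suc_left[OF A]
    by (rule assoc_mult_mat_vec[OF A Ak e, symmetric])
  finally show ?case using Suc.hyps by simp
qed

end
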